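(* Let $B$ be a discrete abelian group, $\alpha\in\mathrm{Aut}(B)$, and let $\chi\in K=\hat B$ have minimal period $p\in\mathbb{N}$, i.e. $\hat\alpha^p\chi=\chi$ and $\hat\alpha^k\chi\neq\chi$ for $1\le k<p$. Let $B(\chi)=B/\{b\in B\mid\chi(b)=1\}$ and $G(\chi)=B(\chi)\rtimes_\alpha\mathbb{Z}_p$, where $\mathbb{Z}_p=\mathbb{Z}/p\mathbb{Z}$ acts on $B(\chi)$ by the action induced by $\alpha$. Then the induced representation $\mathrm{Ind}_{B(\chi)}^{G(\chi)}(\chi)$ is $p$-dimensional and irreducible.
   Context: $K=\hat B$ is the Pontryagin dual of $B$, i.e. the group of all unitary characters of $B$, and the dual automorphism $\hat\alpha$ of $K$ is $(\hat\alpha\chi)(b)=\chi(\alpha(b))$. For $\chi$ of minimal period $p$, set $B(\chi)=B/\{b\in B\mid\chi(b)=1\}$. Then $\alpha$ induces an action of $\mathbb{Z}_p=\mathbb{Z}/p\mathbb{Z}$ on $B(\chi)$, and $G(\chi)=B(\chi)\rtimes_\alpha\mathbb{Z}_p$ is the corresponding semidirect product: the set of pairs $(j,b)$, $j\in\mathbb{Z}_p$, $b\in B(\chi)$, with product $(j,b)(k,c)=(j+k,\alpha^j(c)+b)$. The group $B(\chi)$ is identified with the subgroup $\{(0,b)\mid b\in B(\chi)\}$, and $\chi$ also denotes the character of $B(\chi)$ induced by $\chi$. The representation $\mathrm{Ind}_{B(\chi)}^{G(\chi)}(\chi)$ acts by right translation, $(U(g_1)F)(g_2)=F(g_2g_1)$,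 on the Hilbert space of functions $F:G(\chi)\to\mathbb{C}$ with $F(j,b)=\chi(b)F(j,0)$, with norm $\|F\|^2=\sum_{j\in\mathbb{Z}_p}|F(j,0)|^2$.
   Formalization: α need not preserve {b | χ(b)=1} (swap on Z², χ(a,b)=e^{ita}, t/2π irrational), so G(χ) may be undefined; the claim is proved when α maps this kernel into itself, and for every χ with B(χ) replaced by B/{b | χ(α^k b)=1 for all k}. *)

theory Defs
  imports
    Complex_Main
    "HOL-Algebra.Elementary_Groups"
    "HOL-Library.Function_Algebras"
begin

section \<open>Pontryagin dual of a discrete abelian group\<close>

definition circle_group :: "complex monoid" where
  "circle_group = \<lparr>carrier = {z. cmod z = 1}, monoid.mult = (*), one = 1\<rparr>"

text \<open>Characters are made extensional on the carrier, so that equality of characters is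
  equality of functions. Since the group is discrete, every homomorphism is continuous.\<close>

definition dual_group :: "('a, 'm) monoid_scheme \<Rightarrow> ('a \<Rightarrow> complex) monoid" where
  "dual_group B = \<lparr>carrier = hom B circle_group \<inter> extensional (carrier B),
     monoid.mult = (\<lambda>\<chi> \<psi>. \<lambda>b\<in>carrier B. \<chi> b * \<psi> b),
     one = (\<lambda>b\<in>carrier B. 1)\<rparr>"

definition dual_aut ::
  "('a, 'm) monoid_scheme \<Rightarrow> ('a \<Rightarrow> 'a) \<Rightarrow> ('a \<Rightarrow> complex) \<Rightarrow> ('a \<Rightarrow> complex)" where
  "dual_aut B \<alpha> \<chi> = (\<lambda>b\<in>carrier B. \<chi> (\<alpha> b))"


section \<open>Semidirect products and the group \<open>G(\<chi>)\<close>\<close>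

definition semidirect ::
  "('a, 'm) monoid_scheme \<Rightarrow> ('j, 'n) monoid_scheme \<Rightarrow> ('j \<Rightarrow> 'a \<Rightarrow> 'a) \<Rightarrow> ('j \<times> 'a) monoid" where
  "semidirect A H \<theta> = \<lparr>carrier = carrier H \<times> carrier A,
     monoid.mult = (\<lambda>(j, b) (k, c). (j \<otimes>\<^bsub>H\<^esub> k, \<theta> j c \<otimes>\<^bsub>A\<^esub> b)),
     one = (\<one>\<^bsub>H\<^esub>, \<one>\<^bsub>A\<^esub>)\<rparr>"

definition char_kernel :: "('a, 'm) monoid_scheme \<Rightarrow> ('a \<Rightarrow> complex) \<Rightarrow> 'a set" where
  "char_kernel B \<chi> = {b \<in> carrier B. \<chi> b = 1}"

text \<open>An automorphism \<open>\<alpha>\<close> induces a map on \<open>B / char_kernel B \<chi>\<close> only if it maps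
  the kernel into itself, which may fail for a periodic \<open>\<chi>\<close>.  The following set is the
  kernel of the whole orbit of \<open>\<chi>\<close>. If the orbit is finite, it is the largest
  \<open>\<alpha>\<close>-invariant subgroup of the kernel, and it is the kernel itself whenever the latter is
  \<open>\<alpha>\<close>-invariant (lemma \<open>orbit_kernel_eq_char_kernel\<close> below).  The
  definitions of \<open>B(\<chi>)\<close> and \<open>G(\<chi>)\<close> take the subgroup \<open>N\<close> to be factored out as a
  parameter.\<close>

definition orbit_kernel ::
  "('a, 'm) monoid_scheme \<Rightarrow> ('a \<Rightarrow> 'a) \<Rightarrow> ('a \<Rightarrow> complex) \<Rightarrow> 'a set" where
  "orbit_kernel B \<alpha> \<chi> = {b \<in> carrier B. \<forall>k::nat. \<chi> ((\<alpha> ^^ k) b) = 1}"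

lemma orbit_kernel_eq_char_kernel:
  assumes "\<alpha> ` char_kernel B \<chi> \<subseteq> char_kernel B \<chi>"
  shows "orbit_kernel B \<alpha> \<chi> = char_kernel B \<chi>"
proof
  show "orbit_kernel B \<alpha> \<chi> \<subseteq> char_kernel B \<chi>"
    by (force simp: orbit_kernel_def char_kernel_def dest: spec[where x = "0::nat"])
  have "(\<alpha> ^^ k) b \<in> char_kernel B \<chi>" if "b \<in> char_kernel B \<chi>" for k b
    using that assms by (induction k) auto
  then show "char_kernel B \<chi> \<subseteq> orbit_kernel B \<alpha> \<chi>"
    by (auto simp: orbit_kernel_def char_kernel_def)
qed

text \<open>The map \<open>b + N \<mapsto> \<alpha>(b) + N\<close>; the union is over a single coset when
  \<open>\<alpha>\<close> maps \<open>N\<close> into itself.\<close>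

definition quot_map ::
  "('a, 'm) monoid_scheme \<Rightarrow> 'a set \<Rightarrow> ('a \<Rightarrow> 'a) \<Rightarrow> 'a set \<Rightarrow> 'a set" where
  "quot_map B N \<alpha> X = (\<Union>x\<in>X. N #>\<^bsub>B\<^esub> \<alpha> x)"

definition quot_char :: "('a \<Rightarrow> complex) \<Rightarrow> 'a set \<Rightarrow> complex" where
  "quot_char \<chi> X = the_elem (\<chi> ` X)"

text \<open>The elements of \<open>integer_mod_group p\<close> are the integers \<open>0, \<dots>, p - 1\<close> (for \<open>p > 0\<close>).\<close>

definition G_chi ::
  "('a, 'm) monoid_scheme \<Rightarrow> 'a set \<Rightarrow> ('a \<Rightarrow> 'a) \<Rightarrow> nat \<Rightarrow> (int \<times> 'a set) monoid" where
  "G_chi B N \<alpha> p =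
     semidirect (B Mod N) (integer_mod_group p) (\<lambda>j. quot_map B N \<alpha> ^^ nat j)"


section \<open>Representations on spaces of functions\<close>

definition fscale :: "complex \<Rightarrow> ('g \<Rightarrow> complex) \<Rightarrow> ('g \<Rightarrow> complex)" where
  "fscale c F = (\<lambda>x. c * F x)"

lemma vector_space_fscale: "vector_space fscale"
  by unfold_locales (auto simp: fscale_def fun_eq_iff algebra_simps)

text \<open>\<open>V\<close> is a subspace of functions, \<open>nrm\<close> a Hilbert space norm on it. A bijective linear
  isometry of \<open>V\<close> is a unitary operator.\<close>

definition unitary_rep ::
  "('h, 'n) monoid_scheme \<Rightarrow> ('g \<Rightarrow> complex) set \<Rightarrow> (('g \<Rightarrow> complex) \<Rightarrow> real) \<Rightarrow>
     ('h \<Rightarrow> ('g \<Rightarrow> complex) \<Rightarrow> ('g \<Rightarrow> complex)) \<Rightarrow> bool" where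
  "unitary_rep G V nrm U \<longleftrightarrow>
     group G \<and> module.subspace fscale V \<and>
     (\<forall>g\<in>carrier G. bij_betw (U g) V V \<and>
        (\<forall>F\<in>V. \<forall>F'\<in>V. U g (F + F') = U g F + U g F') \<and>
        (\<forall>c. \<forall>F\<in>V. U g (fscale c F) = fscale c (U g F)) \<and>
        (\<forall>F\<in>V. nrm (U g F) = nrm F)) \<and>
     (\<forall>g\<in>carrier G. \<forall>h\<in>carrier G. \<forall>F\<in>V. U (g \<otimes>\<^bsub>G\<^esub> h) F = U g (U h F))"

text \<open>No closedness is required of the invariant subspaces \<open>W\<close>; for the finite-dimensional
  \<open>V\<close> considered here every subspace is closed.\<close>

definition irreducible_rep ::
  "('h, 'n) monoid_scheme \<Rightarrow> ('g \<Rightarrow> complex) set \<Rightarrow>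
     ('h \<Rightarrow> ('g \<Rightarrow> complex) \<Rightarrow> ('g \<Rightarrow> complex)) \<Rightarrow> bool" where
  "irreducible_rep G V U \<longleftrightarrow>
     V \<noteq> {0} \<and>
     (\<forall>W. module.subspace fscale W \<and> W \<subseteq> V \<and> (\<forall>g\<in>carrier G. U g ` W \<subseteq> W)
        \<longrightarrow> W = {0} \<or> W = V)"


section \<open>The induced representation\<close>

text \<open>A function on the group is represented by a function on the type that vanishes outside
  the carrier, so that pointwise operations are those of the type.\<close>

definition ind_space ::
  "('a, 'm) monoid_scheme \<Rightarrow> 'a set \<Rightarrow> ('a \<Rightarrow> 'a) \<Rightarrow> nat \<Rightarrow> ('a \<Rightarrow> complex) \<Rightarrow>
     (int \<times> 'a set \<Rightarrow> complex) set" where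
  "ind_space B N \<alpha> p \<chi> = {F.
     (\<forall>x. x \<notin> carrier (G_chi B N \<alpha> p) \<longrightarrow> F x = 0) \<and>
     (\<forall>j\<in>carrier (integer_mod_group p). \<forall>b\<in>carrier (B Mod N).
        F (j, b) = quot_char \<chi> b * F (j, \<one>\<^bsub>B Mod N\<^esub>))}"

definition ind_norm ::
  "('a, 'm) monoid_scheme \<Rightarrow> 'a set \<Rightarrow> nat \<Rightarrow> (int \<times> 'a set \<Rightarrow> complex) \<Rightarrow> real" where
  "ind_norm B N p F =
     sqrt (\<Sum>j\<in>carrier (integer_mod_group p). (cmod (F (j, \<one>\<^bsub>B Mod N\<^esub>)))\<^sup>2)"

definition right_transl ::
  "('g, 'n) monoid_scheme \<Rightarrow> 'g \<Rightarrow> ('g \<Rightarrow> complex) \<Rightarrow> ('g \<Rightarrow> complex)" where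
  "right_transl G g F = (\<lambda>x. if x \<in> carrier G then F (x \<otimes>\<^bsub>G\<^esub> g) else 0)"

end

theory Submission
  imports Defs
begin

text \<open>
  The reason is the one behind Mackey's method of little groups. Let a finite group \<open>H\<close> act on a
  group \<open>A\<close>, and let \<open>\<psi>\<close> be a character of \<open>A\<close> that is moved by every nontrivial element of \<open>H\<close>.
  A function in the space of the induced representation is determined by its values at the points
  \<open>(j, 1)\<close> with \<open>j \<in> H\<close>, and these can be prescribed freely, so the dimension is \<open>card H\<close>. In these
  coordinates (lemma \<open>transl_apply\<close>) an element of \<open>A\<close> acts diagonally, by the character
  \<open>\<psi> \<circ> \<theta> j\<close> in coordinate \<open>j\<close>, and an element of \<open>H\<close> permutes the coordinates. Both kinds of
  operators are unitary.

  For irreducibility, take a nonzero function of least support in an invariant subspace \<open>W\<close>. If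
  its support contained two points \<open>j \<noteq> k\<close>, some \<open>a \<in> A\<close> would separate the characters
  \<open>\<psi> \<circ> \<theta> j\<close> and \<open>\<psi> \<circ> \<theta> k\<close> (lemma \<open>orbit_separated\<close>), and subtracting the eigenvalue at \<open>j\<close> from
  the operator of \<open>a\<close> would give a nonzero function in \<open>W\<close> whose support omits \<open>j\<close>. So \<open>W\<close> contains a
  function supported at one coordinate; since \<open>H\<close> permutes the coordinates transitively, it
  contains all of them and is the whole space.

  To apply this to \<open>A = B(\<chi>)\<close> and \<open>H = \<int>/p\<close>, let \<open>N\<close> be the kernel of the whole orbit of \<open>\<chi>\<close>.
  Two elements \<open>x, y\<close> of \<open>B\<close> lie in the same coset of \<open>N\<close> exactly if all characters
  \<open>\<chi> \<circ> \<alpha>\<^sup>k\<close> agree on them (lemma \<open>coset_eq_iff\<close>). So \<open>\<alpha>\<close> and \<open>\<chi>\<close> descend to the quotient, and the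
  periodicity of \<open>\<chi>\<close> makes \<open>\<alpha>\<^sup>p\<close> trivial there, even where it is nontrivial on \<open>B\<close>. Minimality
  of the period is the hypothesis that \<open>\<psi>\<close> is moved by the nonzero elements of \<open>\<int>/p\<close>. The case of an
  \<open>\<alpha>\<close>-invariant kernel is included, because then \<open>N\<close> is the kernel of \<open>\<chi>\<close>.
\<close>

section \<open>Semidirect products and right translations\<close>

text \<open>
  In the product \<open>(j, b) (k, c) = (j k, \<theta> j c \<cdot> b)\<close> the twisted factor stands on the left, so
  for a noncommutative \<open>A\<close> this is the semidirect product with the opposite group of \<open>A\<close>.
\<close>
lemma group_semidirect:
  assumes "group A" and "group H"
    and hom: "\<And>j. j \<in> carrier H \<Longrightarrow> \<theta> j \<in> hom A A"
    and mult: "\<And>j k a. j \<in> carrier H \<Longrightarrow> k \<in> carrier H \<Longrightarrow> a \<in> carrier A \<Longrightarrow>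
      \<theta> (j \<otimes>\<^bsub>H\<^esub> k) a = \<theta> j (\<theta> k a)"
    and one: "\<And>a. a \<in> carrier A \<Longrightarrow> \<theta> \<one>\<^bsub>H\<^esub> a = a"
  shows "group (semidirect A H \<theta>)"
proof -
  interpret A: group A by fact
  interpret H: group H by fact
  note closed = hom_in_carrier [OF hom] and distr = hom_mult [OF hom]
  show ?thesis
  proof (rule groupI)
    fix x assume "x \<in> carrier (semidirect A H \<theta>)"
    then obtain j b where x: "x = (j, b)" "j \<in> carrier H" "b \<in> carrier A"
      by (auto simp: semidirect_def)
    let ?y = "(inv\<^bsub>H\<^esub> j, \<theta> (inv\<^bsub>H\<^esub> j) (inv\<^bsub>A\<^esub> b))"
    have "\<theta> (inv\<^bsub>H\<^esub> j) b \<otimes>\<^bsub>A\<^esub> \<theta> (inv\<^bsub>H\<^esub> j) (inv\<^bsub>A\<^esub> b) = \<theta> (inv\<^bsub>H\<^esub> j) \<one>\<^bsub>A\<^esub>"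
      using x distr [of "inv\<^bsub>H\<^esub> j" b "inv\<^bsub>A\<^esub> b"] by simp
    also have "\<dots> = \<one>\<^bsub>A\<^esub>"
      using x by (intro hom_one [OF hom]) (auto intro: A.group_axioms)
    finally have "?y \<otimes>\<^bsub>semidirect A H \<theta>\<^esub> x = \<one>\<^bsub>semidirect A H \<theta>\<^esub>"
      using x by (simp add: semidirect_def)
    moreover have "?y \<in> carrier (semidirect A H \<theta>)"
      using x closed by (simp add: semidirect_def)
    ultimately show "\<exists>y\<in>carrier (semidirect A H \<theta>).
        y \<otimes>\<^bsub>semidirect A H \<theta>\<^esub> x = \<one>\<^bsub>semidirect A H \<theta>\<^esub>"
      by blast
  qed (auto simp: semidirect_def closed distr mult one A.m_assoc H.m_assoc)
qed

lemma right_transl_mult: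
  assumes "group G" and "g \<in> carrier G" and "h \<in> carrier G"
  shows "right_transl G (g \<otimes>\<^bsub>G\<^esub> h) F = right_transl G g (right_transl G h F)"
proof -
  interpret group G by fact
  show ?thesis
    using assms(2,3) by (auto simp: right_transl_def fun_eq_iff m_assoc)
qed

lemma right_transl_one:
  assumes "group G" and "\<And>x. x \<notin> carrier G \<Longrightarrow> F x = 0"
  shows "right_transl G \<one>\<^bsub>G\<^esub> F = F"
proof -
  interpret group G by fact
  show ?thesis
    using assms(2) by (auto simp: right_transl_def fun_eq_iff)
qed

lemma right_transl_add: "right_transl G g (F + F') = right_transl G g F + right_transl G g F'"
  by (simp add: right_transl_def fun_eq_iff)

lemma right_transl_fscale: "right_transl G g (fscale c F) = fscale c (right_transl G g F)"
  by (simp add: right_transl_def fscale_def fun_eq_iff)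

text \<open>
  The translation by the inverse element is the inverse operator; on functions that do not vanish
  outside the carrier this would fail, since every translate vanishes there.
\<close>
lemma bij_betw_right_transl:
  assumes "group G"
    and supp: "\<And>F x. F \<in> V \<Longrightarrow> x \<notin> carrier G \<Longrightarrow> F x = 0"
    and inv: "\<And>g F. g \<in> carrier G \<Longrightarrow> F \<in> V \<Longrightarrow> right_transl G g F \<in> V"
    and g: "g \<in> carrier G"
  shows "bij_betw (right_transl G g) V V"
proof -
  interpret group G by fact
  have *: "right_transl G h (right_transl G h' F) = F"
    if "h \<in> carrier G" "h' \<in> carrier G" "h \<otimes>\<^bsub>G\<^esub> h' = \<one>\<^bsub>G\<^esub>" "F \<in> V" for h h' F
    using that right_transl_mult [OF \<open>group G\<close>, of h h' F]
      right_transl_one [OF \<open>group G\<close>, of F] supp by simp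
  show ?thesis
    by (rule bij_betw_byWitness [where f' = "right_transl G (inv\<^bsub>G\<^esub> g)"])
      (use g * inv in auto)
qed

lemma subspace_fscale_iff:
  "module.subspace fscale V \<longleftrightarrow>
     0 \<in> V \<and> (\<forall>F\<in>V. \<forall>F'\<in>V. F + F' \<in> V) \<and> (\<forall>c. \<forall>F\<in>V. fscale c F \<in> V)"
proof -
  interpret vector_space fscale by (rule vector_space_fscale)
  show ?thesis by (auto simp: subspace_def)
qed

section \<open>Inducing a character with free orbit\<close>

text \<open>
  The assumption \<open>free\<close> says that the characters \<open>\<psi> \<circ> \<theta> j\<close> with \<open>j \<noteq> 1\<close> differ from \<open>\<psi>\<close>, that is, that
  the stabilizer of \<open>\<psi>\<close> in \<open>H\<close> is trivial. In Mackey's terminology the little group is trivial,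
  which is why inducing from \<open>A\<close> alone gives an irreducible representation.
\<close>
locale free_orbit_character =
  A: group A + H: group H
  for A :: "('a, 'm) monoid_scheme" and H :: "('j, 'n) monoid_scheme" +
  fixes \<theta> :: "'j \<Rightarrow> 'a \<Rightarrow> 'a" and \<psi> :: "'a \<Rightarrow> complex"
  assumes finite_H: "finite (carrier H)"
    and action_hom: "j \<in> carrier H \<Longrightarrow> \<theta> j \<in> hom A A"
    and action_mult: "\<lbrakk>j \<in> carrier H; k \<in> carrier H; a \<in> carrier A\<rbrakk> \<Longrightarrow>
      \<theta> (j \<otimes>\<^bsub>H\<^esub> k) a = \<theta> j (\<theta> k a)"
    and action_one: "a \<in> carrier A \<Longrightarrow> \<theta> \<one>\<^bsub>H\<^esub> a = a"
    and char_hom: "\<psi> \<in> hom A circle_group"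
    and free: "\<lbrakk>j \<in> carrier H; j \<noteq> \<one>\<^bsub>H\<^esub>\<rbrakk> \<Longrightarrow> \<exists>a\<in>carrier A. \<psi> (\<theta> j a) \<noteq> \<psi> a"
begin

abbreviation G :: "('j \<times> 'a) monoid" where
  "G \<equiv> semidirect A H \<theta>"

abbreviation U :: "'j \<times> 'a \<Rightarrow> ('j \<times> 'a \<Rightarrow> complex) \<Rightarrow> 'j \<times> 'a \<Rightarrow> complex" where
  "U \<equiv> right_transl G"

definition V :: "('j \<times> 'a \<Rightarrow> complex) set" where
  "V = {F. (\<forall>x. x \<notin> carrier G \<longrightarrow> F x = 0) \<and>
     (\<forall>j\<in>carrier H. \<forall>b\<in>carrier A. F (j, b) = \<psi> b * F (j, \<one>\<^bsub>A\<^esub>))}"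

definition nrm :: "('j \<times> 'a \<Rightarrow> complex) \<Rightarrow> real" where
  "nrm F = sqrt (\<Sum>j\<in>carrier H. (cmod (F (j, \<one>\<^bsub>A\<^esub>)))\<^sup>2)"

lemmas action_closed = hom_in_carrier [OF action_hom]
lemmas action_distr = hom_mult [OF action_hom]

lemma action_group_one [simp]: "j \<in> carrier H \<Longrightarrow> \<theta> j \<one>\<^bsub>A\<^esub> = \<one>\<^bsub>A\<^esub>"
  by (intro hom_one [OF action_hom]) (auto intro: A.group_axioms)

lemma char_mult:
  "\<lbrakk>a \<in> carrier A; b \<in> carrier A\<rbrakk> \<Longrightarrow> \<psi> (a \<otimes>\<^bsub>A\<^esub> b) = \<psi> a * \<psi> b"
  using hom_mult [OF char_hom] by (simp add: circle_group_def)

lemma cmod_char: "a \<in> carrier A \<Longrightarrow> cmod (\<psi> a) = 1"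
  using hom_in_carrier [OF char_hom] by (simp add: circle_group_def)

lemma char_one [simp]: "\<psi> \<one>\<^bsub>A\<^esub> = 1"
  using char_mult [of "\<one>\<^bsub>A\<^esub>" "\<one>\<^bsub>A\<^esub>"] cmod_char [of "\<one>\<^bsub>A\<^esub>"] by auto

lemma carrier_G: "carrier G = carrier H \<times> carrier A"
  by (simp add: semidirect_def)

lemma mult_G: "(j, b) \<otimes>\<^bsub>G\<^esub> (k, c) = (j \<otimes>\<^bsub>H\<^esub> k, \<theta> j c \<otimes>\<^bsub>A\<^esub> b)"
  by (simp add: semidirect_def)

lemma group_G: "group G"
  by (rule group_semidirect)
    (auto intro: A.group_axioms H.group_axioms action_hom simp: action_mult action_one)

lemma V_outside: "F \<in> V \<Longrightarrow> x \<notin> carrier G \<Longrightarrow> F x = 0"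
  by (simp add: V_def del: split_paired_All)

lemma V_covariant:
  "\<lbrakk>F \<in> V; j \<in> carrier H; b \<in> carrier A\<rbrakk> \<Longrightarrow> F (j, b) = \<psi> b * F (j, \<one>\<^bsub>A\<^esub>)"
  unfolding V_def by blast

lemma V_I:
  assumes "\<And>x. x \<notin> carrier G \<Longrightarrow> F x = 0"
    and "\<And>j b. \<lbrakk>j \<in> carrier H; b \<in> carrier A\<rbrakk> \<Longrightarrow> F (j, b) = \<psi> b * F (j, \<one>\<^bsub>A\<^esub>)"
  shows "F \<in> V"
  unfolding V_def using assms by blast

lemma V_eqI:
  assumes "F \<in> V" and "F' \<in> V"
    and "\<And>j. j \<in> carrier H \<Longrightarrow> F (j, \<one>\<^bsub>A\<^esub>) = F' (j, \<one>\<^bsub>A\<^esub>)"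
  shows "F = F'"
proof
  fix x
  show "F x = F' x"
  proof (cases "x \<in> carrier G")
    case True
    then obtain j b where "x = (j, b)" "j \<in> carrier H" "b \<in> carrier A"
      by (auto simp: carrier_G)
    then show ?thesis
      using assms V_covariant [of F j b] V_covariant [of F' j b] by simp
  qed (simp add: V_outside assms)
qed

lemma subspace_V: "module.subspace fscale V"
  unfolding subspace_fscale_iff
proof (intro conjI ballI allI)
  fix F F' and c :: complex
  assume F: "F \<in> V"
  show "fscale c F \<in> V"
  proof (rule V_I)
    show "fscale c F (j, b) = \<psi> b * fscale c F (j, \<one>\<^bsub>A\<^esub>)"
      if "j \<in> carrier H" "b \<in> carrier A" for j b
      using V_covariant [OF F that] by (simp add: fscale_def)
  qed (simp add: fscale_def V_outside [OF F])
  assume F': "F' \<in> V"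
  show "F + F' \<in> V"
  proof (rule V_I)
    show "(F + F') (j, b) = \<psi> b * (F + F') (j, \<one>\<^bsub>A\<^esub>)"
      if "j \<in> carrier H" "b \<in> carrier A" for j b
      using V_covariant [OF F that] V_covariant [OF F' that] by (simp add: distrib_left)
  qed (simp add: V_outside [OF F] V_outside [OF F'])
qed (simp add: V_def)

text \<open>
  The matrix of a translation: it is monomial, with the permutation coming from \<open>k\<close> and with
  the unimodular entries \<open>\<psi> (\<theta> j c)\<close>. Unitarity and irreducibility are both read off from it.
\<close>
lemma transl_apply:
  assumes "F \<in> V" and "k \<in> carrier H" and "c \<in> carrier A"
    and "j \<in> carrier H" and "b \<in> carrier A"
  shows "U (k, c) F (j, b) = \<psi> (\<theta> j c) * \<psi> b * F (j \<otimes>\<^bsub>H\<^esub> k, \<one>\<^bsub>A\<^esub>)"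
  using assms V_covariant [of F "j \<otimes>\<^bsub>H\<^esub> k" "\<theta> j c \<otimes>\<^bsub>A\<^esub> b"]
  by (simp add: right_transl_def carrier_G mult_G action_closed char_mult)

lemma transl_in_V:
  assumes "F \<in> V" and "g \<in> carrier G"
  shows "U g F \<in> V"
proof -
  obtain k c where "g = (k, c)" "k \<in> carrier H" "c \<in> carrier A"
    using assms by (auto simp: carrier_G)
  with assms show ?thesis
    by (intro V_I) (simp add: right_transl_def, simp add: transl_apply)
qed

lemma nrm_transl:
  assumes "F \<in> V" and "g \<in> carrier G"
  shows "nrm (U g F) = nrm F"
proof -
  obtain k c where g: "g = (k, c)" "k \<in> carrier H" "c \<in> carrier A"
    using assms by (auto simp: carrier_G)
  have "(\<Sum>j\<in>carrier H. (cmod (U g F (j, \<one>\<^bsub>A\<^esub>)))\<^sup>2) =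
      (\<Sum>j\<in>carrier H. (cmod (F (j \<otimes>\<^bsub>H\<^esub> k, \<one>\<^bsub>A\<^esub>)))\<^sup>2)"
    using assms g
    by (intro sum.cong refl) (simp add: transl_apply norm_mult cmod_char action_closed)
  also have "\<dots> = (\<Sum>j\<in>carrier H. (cmod (F (j, \<one>\<^bsub>A\<^esub>)))\<^sup>2)"
    by (rule sum.reindex_bij_witness
        [where i = "\<lambda>j. j \<otimes>\<^bsub>H\<^esub> inv\<^bsub>H\<^esub> k" and j = "\<lambda>j. j \<otimes>\<^bsub>H\<^esub> k"])
      (use g in \<open>auto simp: H.m_assoc\<close>)
  finally show ?thesis
    by (simp add: nrm_def)
qed

lemma unitary_rep_induced: "unitary_rep G V nrm U"
  unfolding unitary_rep_def
proof (intro conjI ballI allI)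
  show "bij_betw (U g) V V" if "g \<in> carrier G" for g
    using that bij_betw_right_transl [OF group_G, of V g] V_outside transl_in_V by blast
qed (auto simp: group_G subspace_V nrm_transl right_transl_mult [OF group_G]
    right_transl_add right_transl_fscale)

text \<open>
  The basis of the space that is dual to the evaluations at the points \<open>(j, 1)\<close>.
\<close>
definition delta :: "'j \<Rightarrow> 'j \<times> 'a \<Rightarrow> complex" where
  "delta j = (\<lambda>(i, b). if i = j \<and> b \<in> carrier A then \<psi> b else 0)"

lemma delta_apply: "delta j (i, \<one>\<^bsub>A\<^esub>) = (if i = j then 1 else 0)"
  by (simp add: delta_def)

lemma delta_in_V: "j \<in> carrier H \<Longrightarrow> delta j \<in> V"
  by (auto simp: V_def delta_def carrier_G)

lemma inj_delta: "inj delta"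
  by (rule injI) (metis delta_apply zero_neq_one)

lemma sum_fun_apply: "(\<Sum>i\<in>I. f i) x = (\<Sum>i\<in>I. f i x)"
  for f :: "'i \<Rightarrow> 'b \<Rightarrow> complex"
  by (induction I rule: infinite_finite_induct) auto

lemma sum_delta_apply:
  assumes "j \<in> carrier H"
  shows "(\<Sum>i\<in>carrier H. fscale (c i) (delta i)) (j, \<one>\<^bsub>A\<^esub>) = c j"
proof -
  have "(\<Sum>i\<in>carrier H. fscale (c i) (delta i)) (j, \<one>\<^bsub>A\<^esub>) =
      (\<Sum>i\<in>carrier H. if j = i then c i else 0)"
    unfolding sum_fun_apply by (intro sum.cong refl) (simp add: fscale_def delta_apply)
  then show ?thesis
    using assms finite_H by simp
qed

lemma sum_delta_in_subspace:
  assumes "module.subspace fscale W" and "\<And>j. j \<in> carrier H \<Longrightarrow> delta j \<in> W"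
  shows "(\<Sum>i\<in>carrier H. fscale (c i) (delta i)) \<in> W"
proof -
  interpret vector_space fscale by (rule vector_space_fscale)
  show ?thesis
    using assms by (intro subspace_sum subspace_scale) auto
qed

lemma V_expansion:
  assumes "F \<in> V"
  shows "F = (\<Sum>i\<in>carrier H. fscale (F (i, \<one>\<^bsub>A\<^esub>)) (delta i))"
  using assms
  by (intro V_eqI sum_delta_in_subspace subspace_V) (auto simp: sum_delta_apply delta_in_V)

lemma dim_V: "vector_space.dim fscale V = card (carrier H)"
proof -
  interpret vector_space fscale by (rule vector_space_fscale)
  have inj: "inj_on delta (carrier H)"
    using inj_delta by (rule inj_on_subset) simp
  show ?thesis
  proof (rule dim_unique)
    show "delta ` carrier H \<subseteq> V"
      by (auto simp: delta_in_V)
    show "V \<subseteq> span (delta ` carrier H)"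
    proof
      fix F assume "F \<in> V"
      then show "F \<in> span (delta ` carrier H)"
        by (subst V_expansion)
          (assumption, rule sum_delta_in_subspace [OF subspace_span], rule span_base, rule imageI)
    qed
    show "independent (delta ` carrier H)"
    proof (rule independent_if_scalars_zero)
      fix f v
      assume 0: "(\<Sum>v\<in>delta ` carrier H. fscale (f v) v) = 0" and "v \<in> delta ` carrier H"
      then obtain j where j: "v = delta j" "j \<in> carrier H" by blast
      have "f (delta j) = (\<Sum>i\<in>carrier H. fscale (f (delta i)) (delta i)) (j, \<one>\<^bsub>A\<^esub>)"
        using j by (simp add: sum_delta_apply)
      also have "\<dots> = 0"
        using 0 by (simp add: sum.reindex [OF inj])
      finally show "f v = 0" by (simp add: j)
    qed (simp add: finite_H)
    show "card (delta ` carrier H) = card (carrier H)"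
      by (rule card_image [OF inj])
  qed
qed

text \<open>
  A stabilizer that is trivial makes the orbit map injective: if \<open>\<psi> \<circ> \<theta> j = \<psi> \<circ> \<theta> k\<close>, then
  \<open>j k\<inverse>\<close> fixes \<open>\<psi>\<close>. A witness \<open>a\<close> for \<open>j k\<inverse>\<close> is therefore transported by \<open>\<theta> (k\<inverse>)\<close>.
\<close>
lemma orbit_separated:
  assumes "j \<in> carrier H" and "k \<in> carrier H" and "j \<noteq> k"
  obtains a where "a \<in> carrier A" and "\<psi> (\<theta> j a) \<noteq> \<psi> (\<theta> k a)"
proof -
  have "j \<otimes>\<^bsub>H\<^esub> inv\<^bsub>H\<^esub> k \<noteq> \<one>\<^bsub>H\<^esub>"
    using assms H.inv_equality [of j "inv\<^bsub>H\<^esub> k"] by auto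
  then obtain a where a: "a \<in> carrier A" "\<psi> (\<theta> (j \<otimes>\<^bsub>H\<^esub> inv\<^bsub>H\<^esub> k) a) \<noteq> \<psi> a"
    using free [of "j \<otimes>\<^bsub>H\<^esub> inv\<^bsub>H\<^esub> k"] assms by auto
  have "\<theta> k (\<theta> (inv\<^bsub>H\<^esub> k) a) = a"
    using a assms action_mult [of k "inv\<^bsub>H\<^esub> k" a] by (simp add: action_one)
  with a assms show thesis
    by (intro that [of "\<theta> (inv\<^bsub>H\<^esub> k) a"]) (simp_all add: action_mult action_closed)
qed

lemma irreducible_rep_induced: "irreducible_rep G V U"
  unfolding irreducible_rep_def
proof (intro conjI allI impI)
  have "delta \<one>\<^bsub>H\<^esub> \<noteq> 0"
    using delta_apply [of "\<one>\<^bsub>H\<^esub>" "\<one>\<^bsub>H\<^esub>"] by auto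
  then show "V \<noteq> {0}"
    using delta_in_V by blast
next
  fix W
  assume *: "module.subspace fscale W \<and> W \<subseteq> V \<and> (\<forall>g\<in>carrier G. U g ` W \<subseteq> W)"
  interpret vector_space fscale by (rule vector_space_fscale)
  have W: "subspace W" and "W \<subseteq> V"
    and inv: "\<And>g F. g \<in> carrier G \<Longrightarrow> F \<in> W \<Longrightarrow> U g F \<in> W"
    using * by auto
  show "W = {0} \<or> W = V"
  proof (cases "W = {0}")
    case False
    \<comment> \<open>Measure functions by the number of their nonzero coordinates and take a smallest one.\<close>
    define supp where "supp F = {j \<in> carrier H. F (j, \<one>\<^bsub>A\<^esub>) \<noteq> 0}" for F :: "'j \<times> 'a \<Rightarrow> complex"
    have fin: "finite (supp F)" for F
      using finite_H by (simp add: supp_def)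
    have supp_empty: "supp F \<noteq> {}" if "F \<in> W" "F \<noteq> 0" for F
      using that V_eqI [of F 0] \<open>W \<subseteq> V\<close> subspace_0 [OF subspace_V] by (auto simp: supp_def)
    obtain F\<^sub>1 where "F\<^sub>1 \<in> W - {0}"
      using False subspace_0 [OF W] by blast
    then obtain F where F: "F \<in> W" "F \<noteq> 0"
      and least: "\<And>F'. F' \<in> W \<Longrightarrow> F' \<noteq> 0 \<Longrightarrow> card (supp F) \<le> card (supp F')"
      using ex_has_least_nat [of "\<lambda>F. F \<in> W - {0}" F\<^sub>1 "\<lambda>F. card (supp F)"] by auto
    have FV: "F \<in> V"
      using F \<open>W \<subseteq> V\<close> by blast
    obtain k where k: "k \<in> supp F"
      using supp_empty F by blast
    then have kH: "k \<in> carrier H" and Fk: "F (k, \<one>\<^bsub>A\<^esub>) \<noteq> 0"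
      by (auto simp: supp_def)
    have zero: "F (j, \<one>\<^bsub>A\<^esub>) = 0" if j: "j \<in> carrier H" "j \<noteq> k" for j
    proof (rule ccontr)
      assume Fj: "F (j, \<one>\<^bsub>A\<^esub>) \<noteq> 0"
      obtain a where a: "a \<in> carrier A" "\<psi> (\<theta> j a) \<noteq> \<psi> (\<theta> k a)"
        using orbit_separated j kH by blast
      \<comment> \<open>The translation by \<open>a\<close> is diagonal; this combination kills coordinate \<open>j\<close> and keeps \<open>k\<close>.\<close>
      define F' where "F' = U (\<one>\<^bsub>H\<^esub>, a) F - fscale (\<psi> (\<theta> j a)) F"
      have F'W: "F' \<in> W"
        unfolding F'_def using W F a
        by (intro subspace_diff subspace_scale inv) (auto simp: carrier_G)
      have F'_apply: "F' (i, \<one>\<^bsub>A\<^esub>) = (\<psi> (\<theta> i a) - \<psi> (\<theta> j a)) * F (i, \<one>\<^bsub>A\<^esub>)"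
        if "i \<in> carrier H" for i
        using that a FV by (simp add: F'_def transl_apply fscale_def left_diff_distrib)
      have "F' \<noteq> 0"
        using F'_apply [OF kH] a Fk by auto
      moreover have "supp F' \<subset> supp F"
      proof
        show "supp F' \<subseteq> supp F"
          using F'_apply by (auto simp: supp_def)
        show "supp F' \<noteq> supp F"
          using F'_apply [OF j(1)] j Fj by (force simp: supp_def)
      qed
      ultimately show False
        using least [OF F'W] psubset_card_mono [OF fin, of "supp F'" F] by simp
    qed
    have "delta j \<in> W" if j: "j \<in> carrier H" for j
    proof -
      \<comment> \<open>Coordinate \<open>i\<close> of the translate is coordinate \<open>i j\<inverse> k\<close> of \<open>F\<close>, which is \<open>k\<close> only if \<open>i = j\<close>.\<close>
      define g where "g = (inv\<^bsub>H\<^esub> j \<otimes>\<^bsub>H\<^esub> k, \<one>\<^bsub>A\<^esub>)"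
      have g: "g \<in> carrier G"
        using j kH by (simp add: g_def carrier_G)
      define F' where "F' = fscale (1 / F (k, \<one>\<^bsub>A\<^esub>)) (U g F)"
      have "F' \<in> W"
        unfolding F'_def using W F g by (intro subspace_scale inv)
      moreover have "F' = delta j"
      proof (rule V_eqI)
        fix i assume i: "i \<in> carrier H"
        have "i \<otimes>\<^bsub>H\<^esub> (inv\<^bsub>H\<^esub> j \<otimes>\<^bsub>H\<^esub> k) = k \<longleftrightarrow> i = j"
        proof
          assume "i \<otimes>\<^bsub>H\<^esub> (inv\<^bsub>H\<^esub> j \<otimes>\<^bsub>H\<^esub> k) = k"
          then have "i \<otimes>\<^bsub>H\<^esub> inv\<^bsub>H\<^esub> j = \<one>\<^bsub>H\<^esub>"
            using i j kH H.r_cancel_one [of k "i \<otimes>\<^bsub>H\<^esub> inv\<^bsub>H\<^esub> j"]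
            by (simp add: H.m_assoc)
          then show "i = j"
            using i j H.inv_equality [of i "inv\<^bsub>H\<^esub> j"] by simp
        qed (use j kH in \<open>simp flip: H.m_assoc\<close>)
        then show "F' (i, \<one>\<^bsub>A\<^esub>) = delta j (i, \<one>\<^bsub>A\<^esub>)"
          using i j kH FV Fk zero [of "i \<otimes>\<^bsub>H\<^esub> (inv\<^bsub>H\<^esub> j \<otimes>\<^bsub>H\<^esub> k)"]
          by (auto simp: F'_def g_def fscale_def transl_apply delta_apply)
      qed (use \<open>F' \<in> W\<close> \<open>W \<subseteq> V\<close> j delta_in_V in auto)
      ultimately show ?thesis by simp
    qed
    then have "F' \<in> W" if "F' \<in> V" for F'
      using that by (subst V_expansion) (assumption, rule sum_delta_in_subspace [OF W])
    with \<open>W \<subseteq> V\<close> show ?thesis by blast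
  qed simp
qed

end

section \<open>The quotient by the kernel of the orbit\<close>

locale periodic_character =
  B: comm_group B
  for B :: "('a, 'm) monoid_scheme" +
  fixes \<alpha> :: "'a \<Rightarrow> 'a" and \<chi> :: "'a \<Rightarrow> complex" and p :: nat
  assumes \<alpha>_hom: "\<alpha> \<in> hom B B"
    and \<chi>_dual: "\<chi> \<in> carrier (dual_group B)"
    and p_pos: "p \<ge> 1"
    and period: "(dual_aut B \<alpha> ^^ p) \<chi> = \<chi>"
    and minimal: "\<lbrakk>1 \<le> k; k < p\<rbrakk> \<Longrightarrow> (dual_aut B \<alpha> ^^ k) \<chi> \<noteq> \<chi>"
begin

abbreviation N :: "'a set" where
  "N \<equiv> orbit_kernel B \<alpha> \<chi>"

lemma \<alpha>_pow_hom: "\<alpha> ^^ k \<in> hom B B"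
proof (induction k)
  case (Suc k)
  then show ?case
    using Group.hom_compose [OF Suc \<alpha>_hom] by (simp only: funpow.simps)
qed (simp add: hom_def)

lemma \<alpha>_pow_closed: "b \<in> carrier B \<Longrightarrow> (\<alpha> ^^ k) b \<in> carrier B"
  by (rule hom_in_carrier [OF \<alpha>_pow_hom])

lemma \<chi>_hom: "\<chi> \<in> hom B circle_group"
  using \<chi>_dual by (simp add: dual_group_def)

lemma \<chi>_pow_mult:
  "\<lbrakk>x \<in> carrier B; y \<in> carrier B\<rbrakk> \<Longrightarrow>
     \<chi> ((\<alpha> ^^ k) (x \<otimes>\<^bsub>B\<^esub> y)) = \<chi> ((\<alpha> ^^ k) x) * \<chi> ((\<alpha> ^^ k) y)"
  using hom_mult [OF \<chi>_hom] by (simp add: hom_mult [OF \<alpha>_pow_hom] \<alpha>_pow_closed circle_group_def)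

lemma \<chi>_nonzero: "b \<in> carrier B \<Longrightarrow> \<chi> b \<noteq> 0"
  using hom_in_carrier [OF \<chi>_hom, of b] by (auto simp: circle_group_def)

lemma \<chi>_pow_one: "\<chi> ((\<alpha> ^^ k) \<one>\<^bsub>B\<^esub>) = 1"
  using \<chi>_pow_mult [of "\<one>\<^bsub>B\<^esub>" "\<one>\<^bsub>B\<^esub>" k] \<chi>_nonzero [OF \<alpha>_pow_closed, of "\<one>\<^bsub>B\<^esub>" k] by simp

lemma \<chi>_pow_diff_eq_one_iff:
  assumes "x \<in> carrier B" and "y \<in> carrier B"
  shows "\<chi> ((\<alpha> ^^ k) (y \<otimes>\<^bsub>B\<^esub> inv\<^bsub>B\<^esub> x)) = 1 \<longleftrightarrow> \<chi> ((\<alpha> ^^ k) y) = \<chi> ((\<alpha> ^^ k) x)"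
proof -
  have "\<chi> ((\<alpha> ^^ k) (y \<otimes>\<^bsub>B\<^esub> inv\<^bsub>B\<^esub> x)) * \<chi> ((\<alpha> ^^ k) x) = \<chi> ((\<alpha> ^^ k) y)"
    using assms by (simp add: B.m_assoc flip: \<chi>_pow_mult)
  then show ?thesis
    using \<chi>_nonzero [OF \<alpha>_pow_closed [OF assms(1)], of k] by auto
qed

lemma subgroup_N: "subgroup N B"
proof (rule B.subgroupI)
  show "inv\<^bsub>B\<^esub> x \<in> N" if "x \<in> N" for x
    using that \<chi>_pow_diff_eq_one_iff [of x "\<one>\<^bsub>B\<^esub>"] \<chi>_pow_one by (auto simp: orbit_kernel_def)
qed (use \<chi>_pow_one in \<open>auto simp: orbit_kernel_def \<chi>_pow_mult\<close>)

lemma normal_N: "N \<lhd> B"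
  by (rule B.subgroup_imp_normal [OF subgroup_N])

text \<open>
  The quotient by the orbit kernel sees of an element exactly the values of the characters
  \<open>\<chi> \<circ> \<alpha>\<^sup>k\<close>. Hence everything about the quotient is reduced to identities between values of \<open>\<chi>\<close>.
\<close>
lemma coset_eq_iff:
  assumes "x \<in> carrier B" and "y \<in> carrier B"
  shows "N #>\<^bsub>B\<^esub> x = N #>\<^bsub>B\<^esub> y \<longleftrightarrow> (\<forall>k. \<chi> ((\<alpha> ^^ k) x) = \<chi> ((\<alpha> ^^ k) y))"
proof -
  have "N #>\<^bsub>B\<^esub> x = N #>\<^bsub>B\<^esub> y \<longleftrightarrow> y \<in> N #>\<^bsub>B\<^esub> x"
    using assms B.repr_independence B.repr_independenceD subgroup_N by metis
  also have "\<dots> \<longleftrightarrow> y \<otimes>\<^bsub>B\<^esub> inv\<^bsub>B\<^esub> x \<in> N"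
    using assms by (intro subgroup.rcos_module [OF subgroup_N]) (auto intro: B.group_axioms)
  finally show ?thesis
    using assms by (auto simp: orbit_kernel_def \<chi>_pow_diff_eq_one_iff)
qed

lemma in_cosetD:
  assumes "x \<in> carrier B" and "y \<in> N #>\<^bsub>B\<^esub> x"
  shows "y \<in> carrier B" and "\<chi> ((\<alpha> ^^ k) y) = \<chi> ((\<alpha> ^^ k) x)"
proof -
  show "y \<in> carrier B"
    using assms B.r_coset_subset_G [OF subgroup.subset [OF subgroup_N]] by blast
  then show "\<chi> ((\<alpha> ^^ k) y) = \<chi> ((\<alpha> ^^ k) x)"
    using assms B.repr_independence [OF assms(2,1) subgroup_N] coset_eq_iff by metis
qed

text \<open>
  Passing from \<open>x\<close> to \<open>\<alpha> x\<close> shifts the sequence of values \<open>\<chi> (\<alpha>\<^sup>k x)\<close> by one, so it respects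
  cosets.
\<close>
lemma quot_map_coset:
  assumes "x \<in> carrier B"
  shows "quot_map B N \<alpha> (N #>\<^bsub>B\<^esub> x) = N #>\<^bsub>B\<^esub> \<alpha> x"
proof -
  have "N #>\<^bsub>B\<^esub> \<alpha> y = N #>\<^bsub>B\<^esub> \<alpha> x" if "y \<in> N #>\<^bsub>B\<^esub> x" for y
  proof -
    have "\<chi> ((\<alpha> ^^ k) (\<alpha> y)) = \<chi> ((\<alpha> ^^ k) (\<alpha> x))" for k
      using in_cosetD(2) [OF assms that, of "Suc k"] by (simp add: funpow_swap1)
    then show ?thesis
      using in_cosetD(1) [OF assms that] assms
      by (simp add: coset_eq_iff hom_in_carrier [OF \<alpha>_hom])
  qed
  then show ?thesis
    using B.rcos_self [OF assms subgroup_N] unfolding quot_map_def by blast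
qed

lemma quot_map_pow_coset:
  "x \<in> carrier B \<Longrightarrow> (quot_map B N \<alpha> ^^ k) (N #>\<^bsub>B\<^esub> x) = N #>\<^bsub>B\<^esub> (\<alpha> ^^ k) x"
  by (induction k) (simp_all add: quot_map_coset \<alpha>_pow_closed)

lemma quot_char_coset:
  assumes "x \<in> carrier B"
  shows "quot_char \<chi> (N #>\<^bsub>B\<^esub> x) = \<chi> x"
proof -
  have "\<chi> y = \<chi> x" if "y \<in> N #>\<^bsub>B\<^esub> x" for y
    using in_cosetD(2) [OF assms that, of 0] by simp
  then have "\<chi> ` (N #>\<^bsub>B\<^esub> x) = {\<chi> x}"
    using B.rcos_self [OF assms subgroup_N] by blast
  then show ?thesis
    by (simp add: quot_char_def)
qed

lemma dual_aut_pow: "(dual_aut B \<alpha> ^^ k) \<chi> = (\<lambda>b\<in>carrier B. \<chi> ((\<alpha> ^^ k) b))"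
proof (induction k)
  case 0
  then show ?case
    using \<chi>_dual by (simp add: dual_group_def extensional_restrict)
next
  case (Suc k)
  then show ?case
    using hom_in_carrier [OF \<alpha>_hom] by (auto simp: dual_aut_def fun_eq_iff funpow_swap1)
qed

lemma \<chi>_pow_mod:
  assumes "b \<in> carrier B"
  shows "\<chi> ((\<alpha> ^^ (n mod p)) b) = \<chi> ((\<alpha> ^^ n) b)"
proof -
  have step: "\<chi> ((\<alpha> ^^ p) x) = \<chi> x" if "x \<in> carrier B" for x
    using fun_cong [OF period, of x] that by (simp add: dual_aut_pow)
  have "\<chi> ((\<alpha> ^^ (p * q + m)) b) = \<chi> ((\<alpha> ^^ m) b)" for q m
  proof (induction q)
    case (Suc q)
    have "\<chi> ((\<alpha> ^^ (p * Suc q + m)) b) = \<chi> ((\<alpha> ^^ p) ((\<alpha> ^^ (p * q + m)) b))"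
      by (simp add: funpow_add add.assoc)
    then show ?case
      using Suc assms by (simp add: step \<alpha>_pow_closed)
  qed simp
  from this [of "n div p" "n mod p"] show ?thesis
    by simp
qed

text \<open>
  Exponents in \<open>\<int>/p\<close> are added modulo \<open>p\<close>, so that \<open>j \<mapsto> \<alpha>\<^sup>j\<close> is an action only because \<open>\<alpha>\<^sup>p\<close> is the
  identity on the quotient. A nonzero \<open>j\<close> is represented by a number strictly between \<open>0\<close> and \<open>p\<close>,
  and therefore moves \<open>\<chi>\<close> by minimality of the period.
\<close>
lemma free_orbit_quotient:
  "free_orbit_character (B Mod N) (integer_mod_group p)
     (\<lambda>j. quot_map B N \<alpha> ^^ nat j) (quot_char \<chi>)"
proof -
  have carrier_p: "carrier (integer_mod_group p) = {0..<int p}"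
    using p_pos by (simp add: carrier_integer_mod_group)
  have carrier_Q: "X \<in> carrier (B Mod N) \<longleftrightarrow> (\<exists>x\<in>carrier B. X = N #>\<^bsub>B\<^esub> x)" for X
    by (auto simp: carrier_FactGroup)
  note coset_mult = normal.rcos_sum [OF normal_N]
  show ?thesis
  proof (intro free_orbit_character.intro free_orbit_character_axioms.intro)
    show "group (B Mod N)"
      by (rule normal.factorgroup_is_group [OF normal_N])
    show "finite (carrier (integer_mod_group p))"
      by (simp add: carrier_p)
    show "quot_map B N \<alpha> ^^ nat j \<in> hom (B Mod N) (B Mod N)" for j
      by (rule homI)
        (auto simp: carrier_Q quot_map_pow_coset coset_mult \<alpha>_pow_closed hom_mult [OF \<alpha>_pow_hom])
    show "quot_char \<chi> \<in> hom (B Mod N) circle_group"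
      using hom_in_carrier [OF \<chi>_hom] hom_mult [OF \<chi>_hom]
      by (intro homI) (auto simp: carrier_Q quot_char_coset coset_mult circle_group_def)
    show "(quot_map B N \<alpha> ^^ nat (j \<otimes>\<^bsub>integer_mod_group p\<^esub> k)) X =
        (quot_map B N \<alpha> ^^ nat j) ((quot_map B N \<alpha> ^^ nat k) X)"
      if jk: "j \<in> carrier (integer_mod_group p)" "k \<in> carrier (integer_mod_group p)"
        and X: "X \<in> carrier (B Mod N)" for j k X
    proof -
      obtain x where x: "x \<in> carrier B" "X = N #>\<^bsub>B\<^esub> x"
        using X carrier_Q by blast
      have "nat ((j + k) mod int p) = (nat j + nat k) mod p"
        using jk by (simp add: carrier_p nat_mod_distrib nat_add_distrib)
      moreover have "N #>\<^bsub>B\<^esub> (\<alpha> ^^ (n mod p)) x = N #>\<^bsub>B\<^esub> (\<alpha> ^^ n) x" for n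
      proof (subst coset_eq_iff; (intro allI)?)
        fix i
        have "\<chi> ((\<alpha> ^^ i) ((\<alpha> ^^ (n mod p)) x)) = \<chi> ((\<alpha> ^^ (n mod p)) ((\<alpha> ^^ i) x))"
          by (metis add.commute comp_apply funpow_add)
        also have "\<dots> = \<chi> ((\<alpha> ^^ n) ((\<alpha> ^^ i) x))"
          using x by (intro \<chi>_pow_mod \<alpha>_pow_closed)
        also have "\<dots> = \<chi> ((\<alpha> ^^ i) ((\<alpha> ^^ n) x))"
          by (metis add.commute comp_apply funpow_add)
        finally show "\<chi> ((\<alpha> ^^ i) ((\<alpha> ^^ (n mod p)) x)) = \<chi> ((\<alpha> ^^ i) ((\<alpha> ^^ n) x))" .
      qed (use x \<alpha>_pow_closed in auto)
      ultimately show ?thesis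
        using x by (simp add: quot_map_pow_coset \<alpha>_pow_closed funpow_add)
    qed
    show "\<exists>X\<in>carrier (B Mod N). quot_char \<chi> ((quot_map B N \<alpha> ^^ nat j) X) \<noteq> quot_char \<chi> X"
      if "j \<in> carrier (integer_mod_group p)" "j \<noteq> \<one>\<^bsub>integer_mod_group p\<^esub>" for j
    proof -
      have "1 \<le> nat j" "nat j < p"
        using that by (auto simp: carrier_p)
      then have "(\<lambda>b\<in>carrier B. \<chi> ((\<alpha> ^^ nat j) b)) \<noteq> (\<lambda>b\<in>carrier B. \<chi> b)"
        using minimal [of "nat j"] dual_aut_pow [of "nat j"] dual_aut_pow [of 0] by simp
      then obtain b where "b \<in> carrier B" "\<chi> ((\<alpha> ^^ nat j) b) \<noteq> \<chi> b"
        by (metis (no_types, lifting) restrict_ext)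
      then show ?thesis
        by (intro bexI [of _ "N #>\<^bsub>B\<^esub> b"])
          (auto simp: carrier_Q quot_map_pow_coset quot_char_coset \<alpha>_pow_closed)
    qed
  qed simp_all
qed

lemma induced_rep_irreducible:
  "unitary_rep (G_chi B N \<alpha> p) (ind_space B N \<alpha> p \<chi>) (ind_norm B N p)
     (right_transl (G_chi B N \<alpha> p))"
  "vector_space.dim fscale (ind_space B N \<alpha> p \<chi>) = p"
  "irreducible_rep (G_chi B N \<alpha> p) (ind_space B N \<alpha> p \<chi>) (right_transl (G_chi B N \<alpha> p))"
proof -
  interpret I: free_orbit_character "B Mod N" "integer_mod_group p"
    "\<lambda>j. quot_map B N \<alpha> ^^ nat j" "quot_char \<chi>"
    by (rule free_orbit_quotient)
  have V: "ind_space B N \<alpha> p \<chi> = I.V"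
    by (simp add: ind_space_def I.V_def G_chi_def)
  have nrm: "ind_norm B N p = I.nrm"
    by (simp add: ind_norm_def I.nrm_def fun_eq_iff)
  have "card (carrier (integer_mod_group p)) = p"
    using p_pos by (simp add: carrier_integer_mod_group)
  then show "vector_space.dim fscale (ind_space B N \<alpha> p \<chi>) = p"
    by (simp add: V I.dim_V)
  show "unitary_rep (G_chi B N \<alpha> p) (ind_space B N \<alpha> p \<chi>) (ind_norm B N p)
      (right_transl (G_chi B N \<alpha> p))"
    using I.unitary_rep_induced by (simp only: V nrm G_chi_def)
  show "irreducible_rep (G_chi B N \<alpha> p) (ind_space B N \<alpha> p \<chi>)
      (right_transl (G_chi B N \<alpha> p))"
    using I.irreducible_rep_induced by (simp only: V G_chi_def)
qed

end

section \<open>Irreducibility of the induced representation\<close>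

theorem theorem7p2:
  fixes B :: "('a, 'm) monoid_scheme"
    and \<alpha> :: "'a \<Rightarrow> 'a"
    and \<chi> :: "'a \<Rightarrow> complex"
    and p :: nat
  assumes "comm_group B"
    and "\<alpha> \<in> iso B B"
    and "\<chi> \<in> carrier (dual_group B)"
    and "p \<ge> 1"
    and "(dual_aut B \<alpha> ^^ p) \<chi> = \<chi>"
    and "\<And>k. 1 \<le> k \<Longrightarrow> k < p \<Longrightarrow> (dual_aut B \<alpha> ^^ k) \<chi> \<noteq> \<chi>"
  shows "(\<alpha> ` char_kernel B \<chi> \<subseteq> char_kernel B \<chi> \<longrightarrow>
      (let N = char_kernel B \<chi>; G = G_chi B N \<alpha> p; V = ind_space B N \<alpha> p \<chi> in
        unitary_rep G V (ind_norm B N p) (right_transl G) \<and>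
        vector_space.dim fscale V = p \<and>
        irreducible_rep G V (right_transl G))) \<and>
      (let N = orbit_kernel B \<alpha> \<chi>; G = G_chi B N \<alpha> p; V = ind_space B N \<alpha> p \<chi> in
        unitary_rep G V (ind_norm B N p) (right_transl G) \<and>
        vector_space.dim fscale V = p \<and>
        irreducible_rep G V (right_transl G))"
proof -
  interpret periodic_character B \<alpha> \<chi> p
    using assms
    by (auto simp: periodic_character_def periodic_character_axioms_def iso_def)
  let ?P = "\<lambda>N. unitary_rep (G_chi B N \<alpha> p) (ind_space B N \<alpha> p \<chi>) (ind_norm B N p)
      (right_transl (G_chi B N \<alpha> p)) \<and>
    vector_space.dim fscale (ind_space B N \<alpha> p \<chi>) = p \<and>
    irreducible_rep (G_chi B N \<alpha> p) (ind_space B N \<alpha> p \<chi>) (right_transl (G_chi B N \<alpha> p))"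
  have P: "?P N"
    using induced_rep_irreducible by blast
  have "?P (char_kernel B \<chi>)" if "\<alpha> ` char_kernel B \<chi> \<subseteq> char_kernel B \<chi>"
    using P unfolding orbit_kernel_eq_char_kernel [OF that] .
  with P show ?thesis
    unfolding Let_def by blast
qed

end
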